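(* Let $\mathcal C=(\mathcal E,\mathcal X,\beta,\mathcal A,\langle-,-\rangle)$ be an abstract cluster structure over a simple directed graph $E$, with principal part $\mathcal C^p$, and let $c$ be a vertex of $E$. The following are equivalent: (a) $\mathcal C$ is skew-symmetrizable at $c$. (b) The principal part $\mathcal C^p$ is skew-symmetrizable at $c$. (c) The map $\delta_{\mathcal Ac}\circ\beta_c\colon\mathcal Xc\to(\mathcal Xc)^*$ is skew-symmetric. (d) The map $\delta_{\mathcal A^pc}\circ\beta^p_c\colon\mathcal Xc\to(\mathcal Xc)^*$ is skew-symmetric.
   Context: $A^*=\mathrm{Hom}_{\mathbb Z}(A,\mathbb Z)$. Signed path category: for a simple directed graph $E$ (no loops, at most one arrow with given source and target), $E_\pm$ has two arrows $\alpha^\pm\colon c\to d$ for each arrow $\alpha\colon c\to d$ of $E$, and $\mathcal E(E)$ is the quotient of the path category of $E_\pm$ by $\gamma^-\circ\alpha^+=\mathrm{id}_c=\gamma^+\circ\alpha^-$ whenever $\alpha\colon c\to d$, $\gamma\colon d\to c$ are arrows of $E$. Abstract cluster structure over $E$: a tuple $(\mathcal E,\mathcal X,\beta,\mathcal A,\langle-,-\rangle)$ with $\mathcal E=\mathcal E(E)$; $\mathcal X\colon\mathcal E^{op}\to\mathrm{Ab}$, $\mathcal A\colon\mathcal E\to\mathrm{Ab}$ free abelian sheaves (functors of the form $\mathrm{Free}_{\mathbb Z}\circ\mathcal B$ with $\mathcal B$ Set-valued; in particular all values are free abelian groups); $\beta$ a factorization, i.e. homomorphisms $\beta_c\colon\mathcal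 Xc\to\mathcal Ac$ with $\beta_d=\mathcal Af\circ\beta_c\circ\mathcal Xf$ for $f\colon c\to d$; and bilinear forms $\langle-,-\rangle_c\colon\mathcal Ac\times\mathcal Xc\to\mathbb Z$ with $\langle a,\mathcal Xf(x)\rangle_c=\langle\mathcal Af(a),x\rangle_d$ for $f\colon c\to d$, right non-degenerate ($\langle-,x\rangle_c=0\Rightarrow x=0$). $\delta_{\mathcal Ac}\colon\mathcal Ac\to(\mathcal Xc)^*$ is $a\mapsto\langle a,-\rangle_c$. Principal part $\mathcal C^p=(\mathcal E,\mathcal X,\beta^p,\mathcal A^p,\langle-,-\rangle^p)$: $\mathcal A^pc=\mathcal Ac/\mathcal Xc^\perp$ where $\mathcal Xc^\perp=\ker\delta_{\mathcal Ac}$, with induced maps; $\beta^p_c$ is $\beta_c$ followed by the quotient map; $\langle a+\mathcal Xc^\perp,x\rangle^p_c=\langle a,x\rangle_c$; $\delta_{\mathcal A^pc}(\bar a)=\langle\bar a,-\rangle_c^p$. $\mathcal C$ is skew-symmetrizable at $c$ if the $\mathcal X$-form $\langle x,y\rangle_{\mathcal Xc}:=\langle\beta_c(x),y\rangle_c$ satisfies $\langle x,y\rangle_{\mathcal Xc}=-\langle y,x\rangle_{\mathcal Xc}$ for all $x,y\in\mathcal Xc$; similarly for $\mathcal C^p$, using $\langle\beta^p_c(x),y\rangle^p_c$. For a free abelian group $A$, a homomorphism $\varphi\colon A\to A^*$ is skew-symmetric if $\varphi^*\circ\delta^{ev}_A=-\varphi$, where $\delta_A^{ev}\colon A\to A^{**}$,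 $a\mapsto(f\mapsto f(a))$. *)

theory Defs
  imports
    "Graph_Theory.Arc_Walk"
    "HOL-Algebra.Elementary_Groups"
    "HOL-Algebra.Free_Abelian_Groups"
begin

section \<open>Small categories and functors to sets and to abelian groups\<close>

record ('o, 'm) category =
  Obj :: "'o set"
  Arr :: "'m set"
  Dom :: "'m \<Rightarrow> 'o"
  Cod :: "'m \<Rightarrow> 'o"
  Ident :: "'o \<Rightarrow> 'm"
  Comp :: "'m \<Rightarrow> 'm \<Rightarrow> 'm"  \<comment> \<open>\<open>Comp C g f\<close> is "g after f"\<close>

definition op_category :: "('o, 'm) category \<Rightarrow> ('o, 'm) category" where
  "op_category C =
     \<lparr>Obj = Obj C, Arr = Arr C, Dom = Cod C, Cod = Dom C, Ident = Ident C,
      Comp = (\<lambda>g f. Comp C f g)\<rparr>"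

record ('o, 'm, 'b) set_fun =
  sob :: "'o \<Rightarrow> 'b set"
  smap :: "'m \<Rightarrow> 'b \<Rightarrow> 'b"

definition set_functor :: "('o, 'm) category \<Rightarrow> ('o, 'm, 'b) set_fun \<Rightarrow> bool" where
  "set_functor C B \<longleftrightarrow>
     (\<forall>f\<in>Arr C. smap B f \<in> sob B (Dom C f) \<rightarrow> sob B (Cod C f)) \<and>
     (\<forall>c\<in>Obj C. \<forall>x\<in>sob B c. smap B (Ident C c) x = x) \<and>
     (\<forall>f\<in>Arr C. \<forall>g\<in>Arr C. Cod C f = Dom C g \<longrightarrow>
        (\<forall>x\<in>sob B (Dom C f). smap B (Comp C g f) x = smap B g (smap B f x)))"

text \<open>Abelian groups are carrier-based commutative groups, hence written
  multiplicatively; all values of a functor live in one type, on carriers.\<close>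

record ('o, 'm, 'g) ab_fun =
  gob :: "'o \<Rightarrow> 'g monoid"
  gmap :: "'m \<Rightarrow> 'g \<Rightarrow> 'g"

definition ab_functor :: "('o, 'm) category \<Rightarrow> ('o, 'm, 'g) ab_fun \<Rightarrow> bool" where
  "ab_functor C F \<longleftrightarrow>
     (\<forall>c\<in>Obj C. comm_group (gob F c)) \<and>
     (\<forall>f\<in>Arr C. gmap F f \<in> hom (gob F (Dom C f)) (gob F (Cod C f))) \<and>
     (\<forall>c\<in>Obj C. \<forall>x\<in>carrier (gob F c). gmap F (Ident C c) x = x) \<and>
     (\<forall>f\<in>Arr C. \<forall>g\<in>Arr C. Cod C f = Dom C g \<longrightarrow>
        (\<forall>x\<in>carrier (gob F (Dom C f)). gmap F (Comp C g f) x = gmap F g (gmap F f x)))"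

definition free_ab_fun :: "('o, 'm, 'b) set_fun \<Rightarrow> ('o, 'm, 'b \<Rightarrow>\<^sub>0 int) ab_fun" where
  "free_ab_fun B =
     \<lparr>gob = (\<lambda>c. free_Abelian_group (sob B c)),
      gmap = (\<lambda>f. frag_extend (\<lambda>b. frag_of (smap B f b)))\<rparr>"

definition naturally_isomorphic ::
    "('o, 'm) category \<Rightarrow> ('o, 'm, 'g) ab_fun \<Rightarrow> ('o, 'm, 'h) ab_fun \<Rightarrow> bool" where
  "naturally_isomorphic C F G \<longleftrightarrow>
     (\<exists>\<eta>. (\<forall>c\<in>Obj C. \<eta> c \<in> iso (gob F c) (gob G c)) \<and>
          (\<forall>f\<in>Arr C. \<forall>x\<in>carrier (gob F (Dom C f)).
             \<eta> (Cod C f) (gmap F f x) = gmap G f (\<eta> (Dom C f) x)))"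

text \<open>"Of the form Free after B" is read up to natural isomorphism. Taking the values of B in
  the type underlying the groups is no restriction: a basis can always be found inside
  the group.\<close>

definition free_abelian_sheaf :: "('o, 'm) category \<Rightarrow> ('o, 'm, 'g) ab_fun \<Rightarrow> bool" where
  "free_abelian_sheaf C F \<longleftrightarrow> ab_functor C F \<and>
     (\<exists>B :: ('o, 'm, 'g) set_fun. set_functor C B \<and> naturally_isomorphic C (free_ab_fun B) F)"


section \<open>The signed path category of a simple directed graph\<close>

text \<open>Vertex and arc sets may be infinite.\<close>

definition simple_directed_graph :: "('v, 'e) pre_digraph \<Rightarrow> bool" where
  "simple_directed_graph E \<longleftrightarrow> loopfree_digraph E \<and> nomulti_digraph E"

datatype sign = Plus | Minus

definition signed_graph :: "('v, 'e) pre_digraph \<Rightarrow> ('v, 'e \<times> sign) pre_digraph" where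
  "signed_graph E =
     \<lparr>verts = verts E, arcs = arcs E \<times> UNIV,
      tail = (\<lambda>a. tail E (fst a)), head = (\<lambda>a. head E (fst a))\<rparr>"

text \<open>The congruence on parallel walks from c to d in the signed graph generated by the two
  relations. Walks list their arcs in order of traversal, so the walk \<open>[a, b]\<close> is the
  composite "b after a".\<close>

inductive signed_path_eq ::
    "('v, 'e) pre_digraph \<Rightarrow> 'v \<Rightarrow> 'v \<Rightarrow> ('e \<times> sign) awalk \<Rightarrow> ('e \<times> sign) awalk \<Rightarrow> bool"
  for E where
  plus_minus: "\<lbrakk>\<alpha> \<in> arcs E; \<gamma> \<in> arcs E; tail E \<alpha> = c; head E \<alpha> = d; tail E \<gamma> = d; head E \<gamma> = c\<rbrakk>
      \<Longrightarrow> signed_path_eq E c c [(\<alpha>, Plus), (\<gamma>, Minus)] []"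
| minus_plus: "\<lbrakk>\<alpha> \<in> arcs E; \<gamma> \<in> arcs E; tail E \<alpha> = c; head E \<alpha> = d; tail E \<gamma> = d; head E \<gamma> = c\<rbrakk>
      \<Longrightarrow> signed_path_eq E c c [(\<alpha>, Minus), (\<gamma>, Plus)] []"
| refl: "pre_digraph.awalk (signed_graph E) c p d \<Longrightarrow> signed_path_eq E c d p p"
| sym: "signed_path_eq E c d p q \<Longrightarrow> signed_path_eq E c d q p"
| trans: "\<lbrakk>signed_path_eq E c d p q; signed_path_eq E c d q r\<rbrakk> \<Longrightarrow> signed_path_eq E c d p r"
| comp: "\<lbrakk>signed_path_eq E c d p p'; signed_path_eq E d e q q'\<rbrakk>
      \<Longrightarrow> signed_path_eq E c e (p @ q) (p' @ q')"

definition signed_path_class ::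
    "('v, 'e) pre_digraph \<Rightarrow> 'v \<Rightarrow> 'v \<Rightarrow> ('e \<times> sign) awalk \<Rightarrow> ('e \<times> sign) awalk set" where
  "signed_path_class E c d p = {q. signed_path_eq E c d p q}"

text \<open>A morphism is a triple of source, class of walks and target; the end points are needed
  because the empty arc list is a walk at every vertex.\<close>

type_synonym ('v, 'e) signed_mor = "'v \<times> ('e \<times> sign) awalk set \<times> 'v"

definition signed_path_category ::
    "('v, 'e) pre_digraph \<Rightarrow> ('v, ('v, 'e) signed_mor) category" where
  "signed_path_category E =
     \<lparr>Obj = verts E,
      Arr = {(c, signed_path_class E c d p, d) | c p d. pre_digraph.awalk (signed_graph E) c p d},
      Dom = (\<lambda>(c, P, d). c),
      Cod = (\<lambda>(c, P, d). d),
      Ident = (\<lambda>c. (c, signed_path_class E c c [], c)),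
      Comp = (\<lambda>(d', Q, e) (c, P, d). (c, \<Union>p\<in>P. \<Union>q\<in>Q. signed_path_class E c e (p @ q), e))\<rparr>"


section \<open>Duals of abelian groups\<close>

text \<open>Elements of the dual are made extensional, so that equality in the dual is equality of
  functionals on the carrier.\<close>

definition dual :: "'g monoid \<Rightarrow> ('g \<Rightarrow> int) monoid" where
  "dual A =
     \<lparr>carrier = hom A integer_group \<inter> extensional (carrier A),
      monoid.mult = (\<lambda>f g. \<lambda>a\<in>carrier A. f a + g a),
      one = (\<lambda>a\<in>carrier A. 0)\<rparr>"

definition dual_map :: "'g monoid \<Rightarrow> 'h monoid \<Rightarrow> ('g \<Rightarrow> 'h) \<Rightarrow> ('h \<Rightarrow> int) \<Rightarrow> ('g \<Rightarrow> int)" where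
  "dual_map A B \<phi> = (\<lambda>\<xi>\<in>carrier (dual B). \<lambda>a\<in>carrier A. \<xi> (\<phi> a))"

definition eval_map :: "'g monoid \<Rightarrow> 'g \<Rightarrow> ('g \<Rightarrow> int) \<Rightarrow> int" where
  "eval_map A = (\<lambda>a\<in>carrier A. \<lambda>f\<in>carrier (dual A). f a)"

definition skew_symmetric_map :: "'g monoid \<Rightarrow> ('g \<Rightarrow> ('g \<Rightarrow> int)) \<Rightarrow> bool" where
  "skew_symmetric_map A \<phi> \<longleftrightarrow>
     \<phi> \<in> hom A (dual A) \<and>
     (\<forall>a\<in>carrier A. dual_map A (dual A) \<phi> (eval_map A a) = inv\<^bsub>dual A\<^esub> (\<phi> a))"


section \<open>Abstract cluster structures\<close>

record ('o, 'm, 'x, 'a) cluster_data =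
  cat :: "('o, 'm) category"
  XX :: "('o, 'm, 'x) ab_fun"
  beta :: "'o \<Rightarrow> 'x \<Rightarrow> 'a"
  AA :: "('o, 'm, 'a) ab_fun"
  pairing :: "'o \<Rightarrow> 'a \<Rightarrow> 'x \<Rightarrow> int"

abbreviation X_at :: "('o, 'm, 'x, 'a) cluster_data \<Rightarrow> 'o \<Rightarrow> 'x monoid" where
  "X_at C c \<equiv> gob (XX C) c"

abbreviation A_at :: "('o, 'm, 'x, 'a) cluster_data \<Rightarrow> 'o \<Rightarrow> 'a monoid" where
  "A_at C c \<equiv> gob (AA C) c"

definition factorization :: "('o, 'm, 'x, 'a) cluster_data \<Rightarrow> bool" where
  "factorization C \<longleftrightarrow>
     (\<forall>c\<in>Obj (cat C). beta C c \<in> hom (X_at C c) (A_at C c)) \<and>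
     (\<forall>f\<in>Arr (cat C). \<forall>x\<in>carrier (X_at C (Cod (cat C) f)).
        beta C (Cod (cat C) f) x =
          gmap (AA C) f (beta C (Dom (cat C) f) (gmap (XX C) f x)))"

definition bilinear_form :: "'a monoid \<Rightarrow> 'x monoid \<Rightarrow> ('a \<Rightarrow> 'x \<Rightarrow> int) \<Rightarrow> bool" where
  "bilinear_form A X b \<longleftrightarrow>
     (\<forall>a\<in>carrier A. (\<lambda>x. b a x) \<in> hom X integer_group) \<and>
     (\<forall>x\<in>carrier X. (\<lambda>a. b a x) \<in> hom A integer_group)"

definition right_nondegenerate :: "'a monoid \<Rightarrow> 'x monoid \<Rightarrow> ('a \<Rightarrow> 'x \<Rightarrow> int) \<Rightarrow> bool" where
  "right_nondegenerate A X b \<longleftrightarrow>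
     (\<forall>x\<in>carrier X. (\<forall>a\<in>carrier A. b a x = 0) \<longrightarrow> x = \<one>\<^bsub>X\<^esub>)"

definition abstract_cluster_structure ::
    "('v, 'e) pre_digraph \<Rightarrow> ('v, ('v, 'e) signed_mor, 'x, 'a) cluster_data \<Rightarrow> bool" where
  "abstract_cluster_structure E C \<longleftrightarrow>
     simple_directed_graph E \<and>
     cat C = signed_path_category E \<and>
     free_abelian_sheaf (op_category (cat C)) (XX C) \<and>
     free_abelian_sheaf (cat C) (AA C) \<and>
     factorization C \<and>
     (\<forall>c\<in>Obj (cat C). bilinear_form (A_at C c) (X_at C c) (pairing C c) \<and>
        right_nondegenerate (A_at C c) (X_at C c) (pairing C c)) \<and>
     (\<forall>f\<in>Arr (cat C). \<forall>a\<in>carrier (A_at C (Dom (cat C) f)).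
        \<forall>x\<in>carrier (X_at C (Cod (cat C) f)).
          pairing C (Dom (cat C) f) a (gmap (XX C) f x) =
          pairing C (Cod (cat C) f) (gmap (AA C) f a) x)"

definition delta :: "('o, 'm, 'x, 'a) cluster_data \<Rightarrow> 'o \<Rightarrow> 'a \<Rightarrow> ('x \<Rightarrow> int)" where
  "delta C c = (\<lambda>a. \<lambda>x\<in>carrier (X_at C c). pairing C c a x)"

definition X_perp :: "('o, 'm, 'x, 'a) cluster_data \<Rightarrow> 'o \<Rightarrow> 'a set" where
  "X_perp C c = kernel (A_at C c) (dual (X_at C c)) (delta C c)"

text \<open>\<open>the_elem (h ` U)\<close> is the value induced on the coset U by a map h that is constant on
  cosets.\<close>

definition principal_part ::
    "('o, 'm, 'x, 'a) cluster_data \<Rightarrow> ('o, 'm, 'x, 'a set) cluster_data" where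
  "principal_part C =
     \<lparr>cat = cat C,
      XX = XX C,
      beta = (\<lambda>c x. X_perp C c #>\<^bsub>A_at C c\<^esub> beta C c x),
      AA = \<lparr>gob = (\<lambda>c. A_at C c Mod X_perp C c),
            gmap = (\<lambda>f U. the_elem ((\<lambda>a. X_perp C (Cod (cat C) f)
                      #>\<^bsub>A_at C (Cod (cat C) f)\<^esub> gmap (AA C) f a) ` U))\<rparr>,
      pairing = (\<lambda>c U x. the_elem ((\<lambda>a. pairing C c a x) ` U))\<rparr>"

definition X_form :: "('o, 'm, 'x, 'a) cluster_data \<Rightarrow> 'o \<Rightarrow> 'x \<Rightarrow> 'x \<Rightarrow> int" where
  "X_form C c x y = pairing C c (beta C c x) y"

definition skew_symmetrizable_at :: "('o, 'm, 'x, 'a) cluster_data \<Rightarrow> 'o \<Rightarrow> bool" where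
  "skew_symmetrizable_at C c \<longleftrightarrow>
     (\<forall>x\<in>carrier (X_at C c). \<forall>y\<in>carrier (X_at C c). X_form C c x y = - X_form C c y x)"

end

theory Submission
  imports Defs
begin

text \<open>Skew-symmetry of a map into the dual is a pointwise condition. The functional obtained
  by applying \<open>\<phi>\<close>, dualized, to evaluation at x is y \<mapsto>
  \<open>\<phi> y x\<close>, so the defining equation says exactly
  \<open>\<phi> y x = - \<phi> x y\<close> (\<open>skew_symmetric_map_iff\<close>). For the
  composite of \<open>beta\<close> and \<open>delta\<close> the number \<open>\<phi> x y\<close> is
  the X-form, which makes skew-symmetrizability and skew-symmetry of that map the same identity
  (\<open>skew_symmetrizable_at_iff\<close>). Passing to the principal part changes neither side:
  elements of \<open>X_perp\<close> pair to zero with everything, so the pairing of a coset is that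
  of any representative (\<open>principal_pairing_coset\<close>). Hence both structures have the
  same X-form at c, and their two maps into the dual agree on the carrier.\<close>

lemma carrier_dual:
  "f \<in> carrier (dual A) \<longleftrightarrow> f \<in> hom A integer_group \<and> f \<in> extensional (carrier A)"
  by (simp add: dual_def)

lemma dual_mult: "f \<otimes>\<^bsub>dual A\<^esub> g = (\<lambda>a\<in>carrier A. f a + g a)"
  by (simp add: dual_def)

lemma dual_one: "\<one>\<^bsub>dual A\<^esub> = (\<lambda>a\<in>carrier A. 0)"
  by (simp add: dual_def)

lemma restrict_in_dual:
  assumes "group A" "f \<in> hom A integer_group"
  shows "restrict f (carrier A) \<in> carrier (dual A)"
  using assms by (auto simp: carrier_dual hom_def group.is_monoid monoid.m_closed)

lemma uminus_in_dual:
  assumes "group A" "f \<in> carrier (dual A)"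
  shows "(\<lambda>a\<in>carrier A. - f a) \<in> carrier (dual A)"
  using assms by (intro restrict_in_dual) (auto simp: carrier_dual hom_def)

text \<open>In a group inverses are unique, so the \<open>inv\<close> in
  \<open>skew_symmetric_map\<close> can be computed as the pointwise negative
  (\<open>dual_inv\<close>). It also lets \<open>restrict_in_dual\<close> be applied to
  \<open>dual A\<close> itself, to reach the double dual.\<close>

lemma group_dual:
  assumes "group A"
  shows "group (dual A)"
proof (rule groupI)
  fix f g assume "f \<in> carrier (dual A)" "g \<in> carrier (dual A)"
  then show "f \<otimes>\<^bsub>dual A\<^esub> g \<in> carrier (dual A)"
    unfolding dual_mult by (intro restrict_in_dual assms) (auto simp: carrier_dual hom_def)
next
  show "\<one>\<^bsub>dual A\<^esub> \<in> carrier (dual A)"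
    unfolding dual_one by (intro restrict_in_dual assms) (auto simp: hom_def)
next
  fix f assume "f \<in> carrier (dual A)"
  then show "\<one>\<^bsub>dual A\<^esub> \<otimes>\<^bsub>dual A\<^esub> f = f"
    by (auto simp: dual_mult dual_one carrier_dual extensional_def)
next
  fix f assume "f \<in> carrier (dual A)"
  then show "\<exists>g\<in>carrier (dual A). g \<otimes>\<^bsub>dual A\<^esub> f = \<one>\<^bsub>dual A\<^esub>"
    by (intro bexI[OF _ uminus_in_dual[OF assms]])
       (auto simp: dual_mult dual_one)
qed (auto simp: dual_mult intro!: restrict_ext)

lemma dual_inv:
  assumes "group A" "f \<in> carrier (dual A)"
  shows "inv\<^bsub>dual A\<^esub> f = (\<lambda>a\<in>carrier A. - f a)"
  by (rule group.inv_equality[OF group_dual[OF assms(1)]])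
     (auto simp: assms uminus_in_dual dual_mult dual_one)

lemma eval_map_in_dual:
  assumes "group A" "a \<in> carrier A"
  shows "eval_map A a \<in> carrier (dual (dual A))"
proof -
  have "(\<lambda>f. f a) \<in> hom (dual A) integer_group"
    using assms(2) by (auto simp: hom_def dual_mult)
  from restrict_in_dual[OF group_dual[OF assms(1)] this] show ?thesis
    using assms(2) by (simp add: eval_map_def)
qed

text \<open>The restricted functions in \<open>dual_map\<close> and \<open>eval_map\<close> take
  their intended values only on carriers. This is why \<open>\<phi> x\<close> must lie in the dual
  and \<open>eval_map A x\<close> in the double dual before the two sides can be compared argument
  by argument.\<close>

lemma skew_symmetric_map_iff:
  assumes "group A" and hom: "\<phi> \<in> hom A (dual A)"
  shows "skew_symmetric_map A \<phi> \<longleftrightarrow> (\<forall>x\<in>carrier A. \<forall>y\<in>carrier A. \<phi> x y = - \<phi> y x)"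
proof -
  have closed: "\<phi> x \<in> carrier (dual A)" if "x \<in> carrier A" for x
    using hom that by (auto simp: hom_def)
  have "dual_map A (dual A) \<phi> (eval_map A x) = (\<lambda>y\<in>carrier A. \<phi> y x)"
    if "x \<in> carrier A" for x
    using that closed eval_map_in_dual[OF assms(1) that]
    by (auto simp: dual_map_def eval_map_def)
  moreover have "(\<lambda>y\<in>carrier A. \<phi> y x) = (\<lambda>y\<in>carrier A. - \<phi> x y) \<longleftrightarrow>
      (\<forall>y\<in>carrier A. \<phi> x y = - \<phi> y x)" for x
    by (auto simp: fun_eq_iff restrict_def)
  ultimately show ?thesis
    by (simp add: skew_symmetric_map_def hom dual_inv[OF assms(1) closed])
qed

text \<open>Linearity of the pairing in its second argument puts the values in the dual; linearity
  in the first makes the map additive.\<close>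

lemma delta_hom:
  assumes "group (A_at C c)" "group (X_at C c)"
    and "bilinear_form (A_at C c) (X_at C c) (pairing C c)"
  shows "delta C c \<in> hom (A_at C c) (dual (X_at C c))"
proof (rule homI)
  show "delta C c a \<in> carrier (dual (X_at C c))" if "a \<in> carrier (A_at C c)" for a
    unfolding delta_def using that assms(2,3)
    by (intro restrict_in_dual) (auto simp: bilinear_form_def)
next
  fix a b assume "a \<in> carrier (A_at C c)" "b \<in> carrier (A_at C c)"
  then show "delta C c (a \<otimes>\<^bsub>A_at C c\<^esub> b) = delta C c a \<otimes>\<^bsub>dual (X_at C c)\<^esub> delta C c b"
    using assms(3) by (auto simp: delta_def dual_mult bilinear_form_def hom_def)
qed

lemma skew_symmetrizable_at_iff:
  assumes "group (A_at C c)" "group (X_at C c)"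
    and "bilinear_form (A_at C c) (X_at C c) (pairing C c)"
    and "beta C c \<in> hom (X_at C c) (A_at C c)"
  shows "skew_symmetrizable_at C c \<longleftrightarrow> skew_symmetric_map (X_at C c) (delta C c \<circ> beta C c)"
proof -
  have "delta C c \<circ> beta C c \<in> hom (X_at C c) (dual (X_at C c))"
    using assms(4) delta_hom[OF assms(1-3)] by (rule hom_compose)
  from skew_symmetric_map_iff[OF assms(2) this] show ?thesis
    by (auto simp: skew_symmetrizable_at_def X_form_def delta_def)
qed

text \<open>The pairing is additive in its first argument and vanishes on \<open>X_perp\<close>, so
  it is constant on the coset of a. This makes the \<open>the_elem\<close> in
  \<open>principal_part\<close> well defined.\<close>

lemma principal_pairing_coset:
  assumes "group (A_at C c)"
    and bil: "bilinear_form (A_at C c) (X_at C c) (pairing C c)"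
    and a: "a \<in> carrier (A_at C c)" and x: "x \<in> carrier (X_at C c)"
  shows "pairing (principal_part C) c (X_perp C c #>\<^bsub>A_at C c\<^esub> a) x = pairing C c a x"
proof -
  interpret A: group "A_at C c" by fact
  have hom: "pairing C c (k \<otimes>\<^bsub>A_at C c\<^esub> a) x = pairing C c k x + pairing C c a x"
    if "k \<in> carrier (A_at C c)" for k
    using bil a x that by (auto simp: bilinear_form_def hom_def)
  have perp: "pairing C c k x = 0" if "k \<in> X_perp C c" for k
  proof -
    have "delta C c k x = \<one>\<^bsub>dual (X_at C c)\<^esub> x"
      using that by (simp add: X_perp_def kernel_def)
    then show ?thesis
      using x by (simp add: delta_def dual_one)
  qed
  \<comment> \<open>Constancy alone would permit an empty image; the unit in \<open>X_perp\<close>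
    puts a into its own coset, so the image is a genuine singleton.\<close>
  have "\<one>\<^bsub>A_at C c\<^esub> \<in> X_perp C c"
  proof -
    have "pairing C c \<one>\<^bsub>A_at C c\<^esub> y = 0" if "y \<in> carrier (X_at C c)" for y
      using hom_one[OF _ A.group_axioms group_integer_group, of "\<lambda>a. pairing C c a y"] bil that
      by (simp add: bilinear_form_def)
    then show ?thesis
      by (auto simp: X_perp_def kernel_def dual_one delta_def)
  qed
  then have "a \<in> X_perp C c #>\<^bsub>A_at C c\<^esub> a"
    using A.l_one[OF a] unfolding r_coset_def by force
  moreover have "pairing C c b x = pairing C c a x" if b: "b \<in> X_perp C c #>\<^bsub>A_at C c\<^esub> a" for b
  proof -
    obtain k where "k \<in> X_perp C c" "b = k \<otimes>\<^bsub>A_at C c\<^esub> a"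
      using b unfolding r_coset_def by blast
    then show ?thesis
      using hom[of k] perp[of k] by (simp add: X_perp_def kernel_def)
  qed
  ultimately have "(\<lambda>a. pairing C c a x) ` (X_perp C c #>\<^bsub>A_at C c\<^esub> a) = {pairing C c a x}"
    by blast
  then show ?thesis
    by (simp add: principal_part_def)
qed

theorem proposition2p20:
  fixes E :: "('v, 'e) pre_digraph"
    and C :: "('v, ('v, 'e) signed_mor, 'x, 'a) cluster_data"
    and c :: 'v
  assumes "abstract_cluster_structure E C"
    and "c \<in> verts E"
  shows "(skew_symmetrizable_at C c
            \<longleftrightarrow> skew_symmetrizable_at (principal_part C) c)
       \<and> (skew_symmetrizable_at (principal_part C) c
            \<longleftrightarrow> skew_symmetric_map (X_at C c) (delta C c \<circ> beta C c))
       \<and> (skew_symmetric_map (X_at C c) (delta C c \<circ> beta C c)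
            \<longleftrightarrow> skew_symmetric_map (X_at C c)
                  (delta (principal_part C) c \<circ> beta (principal_part C) c))"
proof -
  have obj: "c \<in> Obj (cat C)"
    using assms by (simp add: abstract_cluster_structure_def signed_path_category_def)
  have "comm_group (X_at C c)" "comm_group (A_at C c)"
    using assms(1) obj
    by (auto simp: abstract_cluster_structure_def free_abelian_sheaf_def ab_functor_def
        op_category_def)
  then have X: "group (X_at C c)" and A: "group (A_at C c)"
    by (auto intro: comm_group.axioms)
  have bil: "bilinear_form (A_at C c) (X_at C c) (pairing C c)"
    and beta: "beta C c \<in> hom (X_at C c) (A_at C c)"
    using assms(1) obj by (auto simp: abstract_cluster_structure_def factorization_def)
  have same_X: "X_at (principal_part C) c = X_at C c"
    by (simp add: principal_part_def)
  \<comment> \<open>The principal \<open>beta\<close> sends x to the coset of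
    \<open>beta C c x\<close>, whose pairing is read off at that representative.\<close>
  have form_eq: "pairing (principal_part C) c (beta (principal_part C) c x) y =
      pairing C c (beta C c x) y"
    if "x \<in> carrier (X_at C c)" "y \<in> carrier (X_at C c)" for x y
    using principal_pairing_coset[OF A bil hom_in_carrier[OF beta that(1)] that(2)]
    by (simp add: principal_part_def)
  have ab: "skew_symmetrizable_at C c \<longleftrightarrow> skew_symmetrizable_at (principal_part C) c"
    by (simp add: skew_symmetrizable_at_def X_form_def same_X form_eq)
  have ac: "skew_symmetrizable_at C c \<longleftrightarrow> skew_symmetric_map (X_at C c) (delta C c \<circ> beta C c)"
    by (rule skew_symmetrizable_at_iff[OF A X bil beta])
  define \<phi> where "\<phi> = delta C c \<circ> beta C c"
  define \<psi> where "\<psi> = delta (principal_part C) c \<circ> beta (principal_part C) c"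
  \<comment> \<open>Equality as functions, not only on the carrier: both values of
    \<open>delta\<close> are restricted to the same carrier, as the principal part keeps
    \<open>XX\<close>.\<close>
  have agree: "\<psi> x = \<phi> x" if "x \<in> carrier (X_at C c)" for x
    using that by (auto simp: \<phi>_def \<psi>_def delta_def same_X form_eq)
  have \<phi>: "\<phi> \<in> hom (X_at C c) (dual (X_at C c))"
    unfolding \<phi>_def using beta delta_hom[OF A X bil] by (rule hom_compose)
  \<comment> \<open>Transferred from \<open>\<phi>\<close> along \<open>agree\<close>, so the
    argument stays in \<open>X_at C c\<close> and its dual rather than in the quotient.\<close>
  have \<psi>: "\<psi> \<in> hom (X_at C c) (dual (X_at C c))"
  proof (rule homI)
    fix x y assume xy: "x \<in> carrier (X_at C c)" "y \<in> carrier (X_at C c)"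
    then have "x \<otimes>\<^bsub>X_at C c\<^esub> y \<in> carrier (X_at C c)"
      using X by (intro monoid.m_closed group.is_monoid)
    with xy show "\<psi> (x \<otimes>\<^bsub>X_at C c\<^esub> y) = \<psi> x \<otimes>\<^bsub>dual (X_at C c)\<^esub> \<psi> y"
      by (simp add: agree hom_mult[OF \<phi>])
  qed (simp add: agree hom_in_carrier[OF \<phi>])
  have "skew_symmetric_map (X_at C c) \<phi> \<longleftrightarrow> skew_symmetric_map (X_at C c) \<psi>"
    unfolding skew_symmetric_map_iff[OF X \<phi>] skew_symmetric_map_iff[OF X \<psi>]
    by (simp add: agree)
  with ab ac show ?thesis
    unfolding \<phi>_def \<psi>_def by blast
qed

end
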